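(* For integers $m\ge1$ and $n\ge1$, let $a^+_m(n)$ (resp. $a^-_m(n)$) denote the number of partitions of $n$ with exactly $m$ parity blocks, the last parity block being positive (resp. negative). Then \[ a^+_m(n)=(-1)^{m-1}\sum_{l=0}^{m-1}(-1)^{l}\left( p\!\left(n-\tfrac{3l^2+l}{2}\right)-p\!\left(n-\tfrac{3(l+1)^2-(l+1)}{2}\right) \right) \] and \[ a^-_m(n)=(-1)^{m-1}\sum_{l=0}^{m-1}(-1)^l\left( p\!\left(n-\tfrac{3l^2-l}{2}\right)-p\!\left(n-\tfrac{3(l+1)^2+(l+1)}{2}\right) \right). \]
   Context: $p(k)$ denotes the number of partitions of $k$, with $p(0)=1$ and $p(k)=0$ for $k<0$. Every partition $\lambda$ of $n$ is represented by its Frobenius symbol $\begin{pmatrix} x_1 & \cdots & x_d\\ y_1&\cdots & y_d\end{pmatrix}$, where $d$ is the number of cells on the main diagonal of the Ferrers diagram and $x_i$ (resp. $y_i$) is the number of cells in row $i$ to the right of (resp. in column $i$ below) the diagonal. Column $i$ is positive if $x_i-y_i\ge 1$ and negative if $x_i-y_i\le 0$. The parity blocks of $\lambda$ are the maximal sets of contiguous columns all having the same sign; a block is positive (resp. negative) if its columns are positive (resp. negative). *)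

theory Defs
  imports Main
begin

definition is_partition :: "nat list \<Rightarrow> nat \<Rightarrow> bool" where
  "is_partition xs n \<longleftrightarrow> sorted (rev xs) \<and> (\<forall>x\<in>set xs. 0 < x) \<and> sum_list xs = n"

definition partitions_of :: "nat \<Rightarrow> nat list set" where
  "partitions_of n = {xs. is_partition xs n}"

definition pcount :: "int \<Rightarrow> int" where
  "pcount k = (if k < 0 then 0 else int (card (partitions_of (nat k))))"

definition part :: "nat list \<Rightarrow> nat \<Rightarrow> nat" where
  "part xs i = (if 1 \<le> i \<and> i \<le> length xs then xs ! (i - 1) else 0)"

definition conj_part :: "nat list \<Rightarrow> nat \<Rightarrow> nat" where
  "conj_part xs i = card {j. 1 \<le> j \<and> j \<le> length xs \<and> i \<le> part xs j}"

definition diag :: "nat list \<Rightarrow> nat" where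
  "diag xs = card {i. 1 \<le> i \<and> i \<le> length xs \<and> i \<le> part xs i}"

text \<open>Frobenius symbol entries x_i, y_i (cells right of / below the diagonal).\<close>
definition frob_x :: "nat list \<Rightarrow> nat \<Rightarrow> int" where
  "frob_x xs i = int (part xs i) - int i"

definition frob_y :: "nat list \<Rightarrow> nat \<Rightarrow> int" where
  "frob_y xs i = int (conj_part xs i) - int i"

definition pos_col :: "nat list \<Rightarrow> nat \<Rightarrow> bool" where
  "pos_col xs i \<longleftrightarrow> frob_x xs i - frob_y xs i \<ge> 1"

definition same_sign_run :: "nat list \<Rightarrow> nat set \<Rightarrow> bool" where
  "same_sign_run xs B \<longleftrightarrow> (\<exists>a b. 1 \<le> a \<and> a \<le> b \<and> b \<le> diag xs \<and> B = {a..b})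
     \<and> (\<forall>i\<in>B. \<forall>j\<in>B. pos_col xs i = pos_col xs j)"

definition parity_blocks :: "nat list \<Rightarrow> nat set set" where
  "parity_blocks xs = {B. same_sign_run xs B \<and> (\<forall>B'. B \<subset> B' \<longrightarrow> \<not> same_sign_run xs B')}"

definition positive_block :: "nat list \<Rightarrow> nat set \<Rightarrow> bool" where
  "positive_block xs B \<longleftrightarrow> (\<forall>i\<in>B. pos_col xs i)"

definition negative_block :: "nat list \<Rightarrow> nat set \<Rightarrow> bool" where
  "negative_block xs B \<longleftrightarrow> (\<forall>i\<in>B. \<not> pos_col xs i)"

definition last_block :: "nat list \<Rightarrow> nat set" where
  "last_block xs = (THE B. B \<in> parity_blocks xs \<and> diag xs \<in> B)"

definition a_plus :: "nat \<Rightarrow> nat \<Rightarrow> nat" where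
  "a_plus m n = card {xs \<in> partitions_of n. card (parity_blocks xs) = m
                      \<and> positive_block xs (last_block xs)}"

definition a_minus :: "nat \<Rightarrow> nat \<Rightarrow> nat" where
  "a_minus m n = card {xs \<in> partitions_of n. card (parity_blocks xs) = m
                      \<and> negative_block xs (last_block xs)}"

end

theory Submission
  imports Defs
begin

text \<open>
  The arms and legs of the Frobenius symbol form a pair \<open>(X, Y)\<close> of equinumerous finite sets. Scanning
  the integers downwards and counting elements of \<open>X\<close> and \<open>Y\<close> turns \<open>(X, Y)\<close> into a lattice path, on
  which a positive (resp. negative) column is a visit to one side (resp. the other side) of the axis.
  Hence the partitions possessing an alternating sequence of \<open>m\<close> columns with prescribed final sign
  can be counted by iterating the reflection principle: swapping \<open>X\<close> and \<open>Y\<close> above the highest point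
  where the pattern is completed shortens the pattern by one and changes the charge \<open>|X| - |Y|\<close> by two.
  Pairs of charge \<open>-2m\<close> are Maya diagrams of charged partitions, so these counts are
  \<open>p(n - m(3m+1)/2)\<close> for final sign plus and \<open>p(n - m(3m-1)/2)\<close> for final sign minus. An alternating
  sequence of length \<open>m\<close> ending in sign \<open>b\<close> exists iff there are at least \<open>m\<close> blocks when the last
  block has sign \<open>b\<close>, and at least \<open>m + 1\<close> blocks otherwise; so the numbers for consecutive \<open>m\<close> add up to
  a difference of two such counts, and the alternating sum results.
\<close>

section \<open>Alternating patterns and reflection\<close>

text \<open>For the arms this is the index of the last column whose arm is at least
  \<open>v\<close>, because arms strictly decrease; likewise for the legs.\<close>

definition upcount :: "nat set \<Rightarrow> nat \<Rightarrow> nat" where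
  "upcount X v = card {x \<in> X. v \<le> x}"

text \<open>With \<open>X\<close> the arms and \<open>Y\<close> the legs, a step of sign \<open>True\<close> witnesses a column with \<open>y < v \<le> x\<close> and a
  step of sign \<open>False\<close> one with \<open>x \<le> v \<le> y\<close>; \<open>b\<close> is the sign of the last, i.e. lowest, step.\<close>

fun alternates :: "bool \<Rightarrow> nat \<Rightarrow> nat set \<Rightarrow> nat set \<Rightarrow> nat \<Rightarrow> bool" where
  "alternates b 0 X Y u = True"
| "alternates True (Suc m) X Y u =
     (\<exists>v\<ge>u. upcount Y v < upcount X v \<and> alternates False m X Y v)"
| "alternates False (Suc m) X Y u =
     (\<exists>v\<ge>u. upcount X (Suc v) < upcount Y v \<and> alternates True m X Y (Suc v))"

lemma upcount_antimono: "finite X \<Longrightarrow> u \<le> v \<Longrightarrow> upcount X v \<le> upcount X u"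
  unfolding upcount_def by (rule card_mono) auto

lemma upcount_Suc: "upcount X v \<le> Suc (upcount X (Suc v))"
proof (cases "finite {x \<in> X. Suc v \<le> x}")
  case True
  have "upcount X v \<le> card (insert v {x \<in> X. Suc v \<le> x})"
    unfolding upcount_def using True by (rule card_mono[OF finite.insertI]) auto
  also have "\<dots> \<le> Suc (upcount X (Suc v))"
    using True by (simp add: upcount_def card_insert_if)
  finally show ?thesis .
next
  case False
  then have "infinite {x \<in> X. v \<le> x}"
    by (rule contrapos_nn) (auto elim: rev_finite_subset)
  then show ?thesis by (simp add: upcount_def)
qed

lemma upcount_posD: "0 < upcount X v \<Longrightarrow> \<exists>x\<in>X. v \<le> x"
  unfolding upcount_def by (auto simp: card_gt_0_iff)

lemma alternates_antimono:
  "alternates b m X Y v \<Longrightarrow> u \<le> v \<Longrightarrow> alternates b m X Y u"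
  by (cases m; cases b) (auto intro: le_trans)

text \<open>A nonempty pattern needs an element of \<open>X\<close> or \<open>Y\<close> at or above
  its lowest step. Hence the levels carrying it are bounded and \<open>turn\<close> is well
  defined.\<close>

lemma alternates_bound:
  assumes "finite X" "finite Y" "alternates b (Suc m) X Y u"
  shows "u \<le> Max (X \<union> Y)"
proof -
  have "\<exists>v\<ge>u. 0 < upcount X v \<or> 0 < upcount Y v"
    using assms(3) by (cases b) (auto intro: gr_zeroI)
  then obtain x where "x \<in> X \<union> Y" "u \<le> x" using upcount_posD by (metis UnCI le_trans)
  then show ?thesis using assms by (meson Max_ge finite_UnI le_trans)
qed

text \<open>The level of reflection. Taking the highest possible one makes it recoverable from the
  reflected pair.\<close>

definition turn :: "bool \<Rightarrow> nat \<Rightarrow> nat set \<Rightarrow> nat set \<Rightarrow> nat" where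
  "turn b m X Y = (GREATEST u. alternates b (Suc m) X Y u)"

lemma turn:
  assumes "finite X" "finite Y" "alternates b (Suc m) X Y u"
  shows "alternates b (Suc m) X Y (turn b m X Y)" "u \<le> turn b m X Y"
  unfolding turn_def
  using GreatestI_nat[of "alternates b (Suc m) X Y" u "Max (X \<union> Y)"]
    Greatest_le_nat[of "alternates b (Suc m) X Y" u "Max (X \<union> Y)"]
    assms alternates_bound by blast+

lemma turn_eqI:
  assumes "alternates b (Suc m) X Y v" "\<not> alternates b (Suc m) X Y (Suc v)"
  shows "turn b m X Y = v"
  unfolding turn_def
proof (rule Greatest_equality)
  fix u assume "alternates b (Suc m) X Y u"
  then show "u \<le> v" using assms(2) alternates_antimono not_less_eq_eq by blast
qed fact

text \<open>Counts change by at most one per level, so an excess of two at \<open>v\<close> would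
  leave an excess at \<open>Suc v\<close>, and the pattern could be completed higher up.\<close>

lemma turn_True:
  assumes "finite X" "finite Y" "alternates True (Suc m) X Y u"
  defines "v \<equiv> turn True m X Y"
  shows "upcount X v = Suc (upcount Y v)" "alternates False m X Y v"
    "\<not> alternates True (Suc m) X Y (Suc v)"
proof -
  show no: "\<not> alternates True (Suc m) X Y (Suc v)"
    using turn(2)[OF assms(1,2)] v_def by fastforce
  have "alternates True (Suc m) X Y v" using turn[OF assms(1-3)] v_def by simp
  then obtain w where w: "w \<ge> v" "upcount Y w < upcount X w" "alternates False m X Y w" by auto
  with no have wv: "w = v" by (metis alternates.simps(2) not_less_eq_eq le_antisym)
  show alt: "alternates False m X Y v" using w wv by simp
  show "upcount X v = Suc (upcount Y v)"
  proof (rule ccontr)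
    assume "\<not> ?thesis"
    then have big: "Suc (Suc (upcount Y v)) \<le> upcount X v" using w wv by simp
    then have "upcount Y v < upcount X (Suc v)" using upcount_Suc[of X v] by simp
    then have up: "upcount Y (Suc v) < upcount X (Suc v)"
      using upcount_antimono[OF assms(2), of v "Suc v"] by simp
    \<comment> \<open>The next step of the pattern cannot sit at \<open>v\<close> itself, where
      \<open>upcount Y v < upcount X (Suc v)\<close>; so it already lies above.\<close>
    have "alternates False m X Y (Suc v)"
    proof (cases m)
      case (Suc k)
      then obtain t where "t \<ge> v" "upcount X (Suc t) < upcount Y t" "alternates True k X Y (Suc t)"
        using alt by auto
      then show ?thesis using Suc \<open>upcount Y v < upcount X (Suc v)\<close>
        by (auto intro!: exI[of _ t] dest: le_neq_implies_less)
    qed simp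
    with up no show False by auto
  qed
qed

lemma turn_False:
  assumes "finite X" "finite Y" "alternates False (Suc m) X Y u"
  defines "v \<equiv> turn False m X Y"
  shows "upcount Y v = Suc (upcount X (Suc v))" "alternates True m X Y (Suc v)"
    "\<not> alternates False (Suc m) X Y (Suc v)"
proof -
  show no: "\<not> alternates False (Suc m) X Y (Suc v)"
    using turn(2)[OF assms(1,2)] v_def by fastforce
  have "alternates False (Suc m) X Y v" using turn[OF assms(1-3)] v_def by simp
  then obtain w where w: "w \<ge> v" "upcount X (Suc w) < upcount Y w" "alternates True m X Y (Suc w)"
    by auto
  with no have wv: "w = v" by (metis alternates.simps(3) not_less_eq_eq le_antisym)
  show alt: "alternates True m X Y (Suc v)" using w wv by simp
  show "upcount Y v = Suc (upcount X (Suc v))"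
  proof (rule ccontr)
    assume "\<not> ?thesis"
    then have big: "Suc (Suc (upcount X (Suc v))) \<le> upcount Y v" using w wv by simp
    then have less: "upcount X (Suc v) < upcount Y (Suc v)" using upcount_Suc[of Y v] by simp
    then have up: "upcount X (Suc (Suc v)) < upcount Y (Suc v)"
      using upcount_antimono[OF assms(1), of "Suc v" "Suc (Suc v)"] by simp
    have "alternates True m X Y (Suc (Suc v))"
    proof (cases m)
      case (Suc k)
      then obtain t where "t \<ge> Suc v" "upcount Y t < upcount X t" "alternates False k X Y t"
        using alt by auto
      moreover from this less have "t \<noteq> Suc v" by auto
      ultimately show ?thesis using Suc by (auto intro!: exI[of _ t])
    qed simp
    with up no show False by auto
  qed
qed

text \<open>Exchanging the two sets and raising the new first one by one interchanges the strict and
  the weak inequality. A \<open>True\<close> step at \<open>v\<close> becomes a \<open>False\<close>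
  step at \<open>v\<close>, and a \<open>False\<close> step at \<open>v\<close> a
  \<open>True\<close> step at \<open>Suc v\<close>.\<close>

lemma alternates_transfer:
  assumes "\<And>u. v \<le> u \<Longrightarrow> upcount X' (Suc u) = upcount Y u"
    and "\<And>u. v \<le> u \<Longrightarrow> upcount Y' u = upcount X u"
    and "v \<le> u"
  shows "alternates True m X Y u \<longleftrightarrow> alternates False m X' Y' u"
    and "alternates False m X Y u \<longleftrightarrow> alternates True m X' Y' (Suc u)"
  using assms(3)
proof (induction m arbitrary: u)
  case (Suc m)
  { case 1
    then show ?case using Suc assms(1,2) by (auto 4 4 intro: le_trans)
  next
    case 2
    have "alternates True (Suc m) X' Y' (Suc u) \<longleftrightarrow>
      (\<exists>w\<ge>u. upcount Y' (Suc w) < upcount X' (Suc w) \<and> alternates False m X' Y' (Suc w))"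
      unfolding alternates.simps by (metis Suc_le_D Suc_le_mono)
    also have "\<dots> \<longleftrightarrow> (\<exists>w\<ge>u. upcount X (Suc w) < upcount Y w \<and> alternates True m X Y (Suc w))"
    proof -
      have "upcount Y' (Suc w) = upcount X (Suc w)" "upcount X' (Suc w) = upcount Y w"
        "alternates True m X Y (Suc w) = alternates False m X' Y' (Suc w)" if "u \<le> w" for w
        using that 2 assms(1,2) Suc.IH(1) by simp_all
      then show ?thesis by auto
    qed
    finally show ?case by simp }
qed auto

text \<open>The tail exchange of the reflection principle: \<open>splice_at v Y X\<close> and
  \<open>splice_at v X Y\<close> arise from \<open>X\<close> and \<open>Y\<close> by swapping their
  parts at or above \<open>v\<close>.\<close>

definition splice_at :: "nat \<Rightarrow> nat set \<Rightarrow> nat set \<Rightarrow> nat set" where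
  "splice_at v A B = {a \<in> A. v \<le> a} \<union> {b \<in> B. b < v}"

lemma splice_at_splice_at: "splice_at v (splice_at v A B) (splice_at v B A) = A"
  by (auto simp: splice_at_def)

lemma finite_splice_at [simp]: "finite A \<Longrightarrow> finite B \<Longrightarrow> finite (splice_at v A B)"
  by (simp add: splice_at_def)

lemma upcount_splice_at: "v \<le> u \<Longrightarrow> upcount (splice_at v A B) u = upcount A u"
  unfolding upcount_def splice_at_def by (rule arg_cong[of _ _ card]) auto

lemma upcount_Suc_image: "upcount (Suc ` A) (Suc u) = upcount A u"
proof -
  have "{x \<in> Suc ` A. Suc u \<le> x} = Suc ` {x \<in> A. u \<le> x}" by auto
  then show ?thesis by (simp add: upcount_def card_image)
qed

text \<open>Written additively to avoid truncated subtraction. The change of charge under a swap is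
  read off from the two counts at \<open>v\<close>.\<close>

lemma card_splice_at:
  assumes "finite A" "finite B"
  shows "card (splice_at v A B) + upcount B v = upcount A v + card B"
proof -
  have "card (splice_at v A B) = upcount A v + card {b \<in> B. b < v}"
    unfolding splice_at_def upcount_def using assms by (intro card_Un_disjoint) auto
  moreover have "card B = card ({b \<in> B. v \<le> b} \<union> {b \<in> B. b < v})"
    by (rule arg_cong[of _ _ card]) auto
  then have "card B = upcount B v + card {b \<in> B. b < v}"
    unfolding upcount_def using assms by (subst (asm) card_Un_disjoint) auto
  ultimately show ?thesis by simp
qed

lemma sum_splice_at:
  assumes "finite A" "finite B"
  shows "\<Sum>(splice_at v A B) + \<Sum>(splice_at v B A) = \<Sum>A + \<Sum>B"
proof -
  have split: "\<Sum>S = \<Sum>{s \<in> S. v \<le> s} + \<Sum>{s \<in> S. s < v}" if "finite S" for S :: "nat set"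
  proof -
    have "\<Sum>S = \<Sum>({s \<in> S. v \<le> s} \<union> {s \<in> S. s < v})" by (rule arg_cong[of _ _ Sum]) auto
    then show ?thesis using that by (subst (asm) sum.union_disjoint) auto
  qed
  have "\<Sum>(splice_at v S T) = \<Sum>{s \<in> S. v \<le> s} + \<Sum>{s \<in> T. s < v}"
    if "finite S" "finite T" for S T :: "nat set"
    unfolding splice_at_def using that by (subst sum.union_disjoint) auto
  with assms show ?thesis using split[OF assms(1)] split[OF assms(2)] by simp
qed

definition pred_set :: "nat set \<Rightarrow> nat set" where
  "pred_set X = {x. Suc x \<in> X}"

lemma pred_set_Suc [simp]: "pred_set (Suc ` X) = X"
  by (auto simp: pred_set_def)

lemma Suc_pred_set: "X \<subseteq> {Suc a..} \<Longrightarrow> Suc ` pred_set X = X"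
  unfolding pred_set_def image_def by (auto; metis Suc_le_D atLeast_iff subsetD)

lemma finite_pred_set [simp]: "finite X \<Longrightarrow> finite (pred_set X)"
  unfolding pred_set_def by (rule finite_vimageI[of X Suc, unfolded vimage_def]) auto

lemma sum_Suc_image: "finite X \<Longrightarrow> \<Sum>(Suc ` X) = \<Sum>X + card X"
  by (simp add: sum.reindex sum_Suc)

section \<open>Counting pairs by charge\<close>

text \<open>The term \<open>a * card X\<close> makes the weight that of the pair obtained by lowering \<open>X\<close> by \<open>a\<close>. For
  \<open>k = a = 0\<close> it is the size of the partition with arms \<open>X\<close> and legs \<open>Y\<close>.\<close>

definition pairs :: "nat \<Rightarrow> nat \<Rightarrow> int \<Rightarrow> (nat set \<times> nat set) set" where
  "pairs k a N = {(X, Y). finite X \<and> finite Y \<and> X \<subseteq> {a..} \<and> card Y = card X + k \<and>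
     int (\<Sum>X + \<Sum>Y + card Y) - int (a * card X) = N}"

text \<open>Patterns ending in \<open>False\<close> are covered by \<open>a = 1\<close>: raising the
  legs by one and exchanging the two sets makes them end in \<open>True\<close>.\<close>

definition alt_pairs :: "nat \<Rightarrow> nat \<Rightarrow> nat \<Rightarrow> int \<Rightarrow> (nat set \<times> nat set) set" where
  "alt_pairs m k a N = {(X, Y) \<in> pairs k a N. alternates True m X Y a}"

text \<open>This is how a pattern gets shorter: dropping the lowest step of a \<open>True\<close>
  pattern leaves a \<open>False\<close> one above \<open>v\<close>, which the second equivalence
  turns into a \<open>True\<close> one.\<close>

lemma alternates_reflect:
  fixes X Y :: "nat set" and v :: nat
  defines "X' \<equiv> Suc ` splice_at v Y X" and "Y' \<equiv> splice_at v X Y"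
  assumes "v \<le> u"
  shows "alternates True m X Y u \<longleftrightarrow> alternates False m X' Y' u"
    and "alternates False m X Y u \<longleftrightarrow> alternates True m X' Y' (Suc u)"
  using alternates_transfer[of v X' Y Y' X u m] assms
  by (simp_all add: upcount_Suc_image upcount_splice_at)

text \<open>The swap moves a net of one element from \<open>X\<close> to \<open>Y\<close>, so
  \<open>k\<close> grows by two. The sums are preserved, and raising the new first set is absorbed
  by the step from \<open>a\<close> to \<open>Suc a\<close>; what remains is \<open>1\<close> for
  the extra element of \<open>Y\<close> and \<open>a\<close> for the one lost by
  \<open>X\<close>.\<close>

lemma reflect_pairs:
  assumes "finite X" "finite Y" "a \<le> v" "upcount X v = Suc (upcount Y v)"
  shows "(Suc ` splice_at v Y X, splice_at v X Y) \<in> pairs (k + 2) (Suc a) (N + int a + 1)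
    \<longleftrightarrow> (X, Y) \<in> pairs k a N"
proof -
  have c1: "Suc (card (splice_at v Y X)) = card X"
    using card_splice_at[of Y X v] assms by simp
  have c2: "card (splice_at v X Y) = Suc (card Y)"
    using card_splice_at[of X Y v] assms by simp
  have s: "\<Sum>(splice_at v Y X) + \<Sum>(splice_at v X Y) = \<Sum>X + \<Sum>Y"
    using sum_splice_at[of X Y v] assms by simp
  \<comment> \<open>Only elements at or above \<open>v\<close>, hence at or above \<open>a\<close>,
    are exchanged.\<close>
  have sub: "Suc ` splice_at v Y X \<subseteq> {Suc a..} \<longleftrightarrow> X \<subseteq> {a..}"
    using assms(3) by (force simp: splice_at_def subset_iff)
  have "int (\<Sum>(splice_at v Y X)) + int (\<Sum>(splice_at v X Y)) = int (\<Sum>X) + int (\<Sum>Y)"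
    using s by linarith
  moreover have "int a * int (card X) = int a * int (card (splice_at v Y X)) + int a"
    using c1 by (simp flip: c1 add: algebra_simps)
  ultimately show ?thesis
    using assms(1,2) c1 c2 sub
    by (auto simp: pairs_def card_image sum_Suc_image algebra_simps simp del: of_nat_sum)
qed

text \<open>The bound on \<open>a\<close> forces the reflected path to end beyond the axis at level \<open>a\<close>, so that it can
  be reflected back.\<close>

lemma card_alt_pairs_Suc:
  assumes "a \<le> Suc k"
  shows "card (alt_pairs (Suc m) k a N) = card (alt_pairs m (k + 2) (Suc a) (N + int a + 1))"
proof (rule bij_betw_same_card)
  let ?f = "\<lambda>(X, Y). let v = turn True m X Y in (Suc ` splice_at v Y X, splice_at v X Y)"
  let ?g = "\<lambda>(X, Y). let v = turn False m X Y in
    (splice_at v Y (pred_set X), splice_at v (pred_set X) Y)"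
  have f: "?f p \<in> alt_pairs m (k + 2) (Suc a) (N + int a + 1) \<and> ?g (?f p) = p"
    if "p \<in> alt_pairs (Suc m) k a N" for p
  proof -
    obtain X Y where p: "p = (X, Y)" by force
    define v where "v = turn True m X Y"
    have fin: "finite X" "finite Y" and alt: "alternates True (Suc m) X Y a"
      and mem: "(X, Y) \<in> pairs k a N"
      using that by (auto simp: p alt_pairs_def pairs_def)
    note t = turn_True[OF fin alt, folded v_def]
    have v: "alternates True (Suc m) X Y v" "a \<le> v" using turn[OF fin alt] by (simp_all add: v_def)
    define X' Y' where "X' = Suc ` splice_at v Y X" and "Y' = splice_at v X Y"
    note reflect = alternates_reflect[where v=v and X=X and Y=Y, folded X'_def Y'_def]
    \<comment> \<open>From \<open>v\<close> upwards the reflected pair carries a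
      \<open>False\<close> pattern exactly where the original carries a \<open>True\<close> one, so
      the inverse map finds the same level.\<close>
    have "turn False m X' Y' = v"
      using reflect(1)[of v "Suc m"] reflect(1)[of "Suc v" "Suc m"] v t(3) by (intro turn_eqI) auto
    moreover have "alternates True m X' Y' (Suc a)"
      using reflect(2)[of v m] t(2) v(2) alternates_antimono by blast
    moreover have "(X', Y') \<in> pairs (k + 2) (Suc a) (N + int a + 1)"
      using reflect_pairs[OF fin v(2) t(1)] mem by (simp add: X'_def Y'_def)
    ultimately show ?thesis
      by (simp add: p v_def[symmetric] X'_def Y'_def Let_def alt_pairs_def splice_at_splice_at)
  qed
  have g: "?g q \<in> alt_pairs (Suc m) k a N \<and> ?f (?g q) = q"
    if "q \<in> alt_pairs m (k + 2) (Suc a) (N + int a + 1)" for q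
  proof -
    obtain X' Y' where q: "q = (X', Y')" by force
    define v where "v = turn False m X' Y'"
    have fin: "finite X'" "finite Y'" and alt: "alternates True m X' Y' (Suc a)"
      and mem: "(X', Y') \<in> pairs (k + 2) (Suc a) (N + int a + 1)" and sub: "X' \<subseteq> {Suc a..}"
      and cd: "card Y' = card X' + k + 2"
      using that by (auto simp: q alt_pairs_def pairs_def)
    \<comment> \<open>At most \<open>a\<close> elements of \<open>Y'\<close> lie below
      \<open>a\<close>, so at least \<open>card X' + k + 2 - a\<close>, hence more than
      \<open>card X'\<close>, lie at or above it. This forces a \<open>False\<close> step at level
      \<open>a\<close>.\<close>
    have "card Y' \<le> card ({y \<in> Y'. a \<le> y} \<union> {..<a})"
      using fin by (intro card_mono) auto
    also have "\<dots> \<le> upcount Y' a + a"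
      unfolding upcount_def by (rule order.trans[OF card_Un_le]) simp
    finally have "upcount X' (Suc a) < upcount Y' a"
      using cd assms card_mono[OF fin(1), of "{x \<in> X'. Suc a \<le> x}"]
      unfolding upcount_def by auto
    with alt have altF: "alternates False (Suc m) X' Y' a" by auto
    note t = turn_False[OF fin altF, folded v_def]
    have v: "alternates False (Suc m) X' Y' v" "a \<le> v"
      using turn[OF fin altF] by (simp_all add: v_def)
    define X Y where "X = splice_at v Y' (pred_set X')" and "Y = splice_at v (pred_set X') Y'"
    have finXY: "finite X" "finite Y" using fin by (simp_all add: X_def Y_def)
    have inv: "Suc ` splice_at v Y X = X'" "splice_at v X Y = Y'"
      using Suc_pred_set[OF sub] by (simp_all add: X_def Y_def splice_at_splice_at)
    note reflect = alternates_reflect[where v=v and X=X and Y=Y, unfolded inv]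
    have tv: "turn True m X Y = v"
      using reflect(1)[of v "Suc m"] reflect(1)[of "Suc v" "Suc m"] v t(3) by (intro turn_eqI) auto
    have "upcount X v = upcount Y' v" using upcount_splice_at[of v v X Y] inv by simp
    moreover have "upcount Y v = upcount X' (Suc v)"
      using upcount_splice_at[of v v Y X] upcount_Suc_image[of "splice_at v Y X" v] inv by simp
    ultimately have "upcount X v = Suc (upcount Y v)" using t(1) by simp
    then have "(X, Y) \<in> pairs k a N"
      using reflect_pairs[OF finXY v(2), of k N] inv mem by simp
    moreover have "alternates True (Suc m) X Y a"
      using reflect(1)[of v "Suc m"] v alternates_antimono by blast
    ultimately show ?thesis
      using tv inv by (simp add: q v_def[symmetric] X_def[symmetric] Y_def[symmetric]
          Let_def alt_pairs_def)
  qed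
  show "bij_betw ?f (alt_pairs (Suc m) k a N) (alt_pairs m (k + 2) (Suc a) (N + int a + 1))"
    by (rule bij_betw_byWitness[where f' = ?g]) (use f g in blast)+
qed

section \<open>Translating charged pairs\<close>

lemma card_pairs_shift_left: "card (pairs k (Suc a) N) = card (pairs k a N)"
proof (rule bij_betw_same_card[symmetric])
  \<comment> \<open>Raising all of \<open>X\<close> by one is compensated by the term
    \<open>a * card X\<close>, so \<open>N\<close> is unchanged.\<close>
  show "bij_betw (\<lambda>(X, Y). (Suc ` X, Y)) (pairs k a N) (pairs k (Suc a) N)"
  proof (rule bij_betw_byWitness[where f' = "\<lambda>(X, Y). (pred_set X, Y)"])
    have "(pred_set X, Y) \<in> pairs k a N" if "(X, Y) \<in> pairs k (Suc a) N" for X Y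
    proof -
      define Z where "Z = pred_set X"
      have "X = Suc ` Z" "finite Z"
        using that Suc_pred_set[of X a] by (simp_all add: Z_def pairs_def)
      with that show ?thesis
        by (auto simp: pairs_def Z_def[symmetric] card_image sum_Suc_image algebra_simps
            simp del: of_nat_sum)
    qed
    then show "(\<lambda>(X, Y). (pred_set X, Y)) ` pairs k (Suc a) N \<subseteq> pairs k a N" by auto
  next
    show "(\<lambda>(X, Y). (Suc ` X, Y)) ` pairs k a N \<subseteq> pairs k (Suc a) N"
      by (auto simp: pairs_def card_image sum_Suc_image algebra_simps simp del: of_nat_sum)
  next
    show "\<forall>p\<in>pairs k (Suc a) N. (\<lambda>(X, Y). (Suc ` X, Y)) ((\<lambda>(X, Y). (pred_set X, Y)) p) = p"
      by (auto simp: pairs_def Suc_pred_set[of _ a] simp del: of_nat_sum)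
  qed auto
qed

text \<open>Every set of naturals is \<open>push b S\<close> for exactly one \<open>b\<close> and
  \<open>S\<close>; this isolates the place 0, the one that crosses between the two halves of a Maya
  diagram.\<close>

definition push :: "bool \<Rightarrow> nat set \<Rightarrow> nat set" where
  "push b S = Suc ` S \<union> (if b then {0} else {})"

lemma pred_set_push [simp]: "pred_set (push b S) = S" and zero_in_push [simp]: "0 \<in> push b S \<longleftrightarrow> b"
  by (auto simp: push_def pred_set_def)

lemma push_pred_set: "push (0 \<in> S) (pred_set S) = S"
proof -
  have "x \<in> push (0 \<in> S) (pred_set S) \<longleftrightarrow> x \<in> S" for x
    by (cases x) (auto simp: push_def pred_set_def)
  then show ?thesis by blast
qed

lemma finite_push [simp]: "finite (push b S) \<longleftrightarrow> finite S"
  by (auto simp: push_def finite_image_iff)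

lemma card_push [simp]: "finite S \<Longrightarrow> card (push b S) = card S + of_bool b"
  by (subst push_def) (auto simp: card_image card_insert_if)

lemma sum_push [simp]: "finite S \<Longrightarrow> \<Sum>(push b S) = \<Sum>S + card S"
  by (subst push_def) (auto simp: sum_Suc_image sum.insert_if)

text \<open>Translation of the Maya diagram of \<open>(X, Y)\<close> by one unit.\<close>

lemma card_pairs_shift_charge: "card (pairs (Suc k) 0 N) = card (pairs k 0 (N - int (Suc k)))"
proof (rule bij_betw_same_card)
  \<comment> \<open>\<open>X\<close> records the particles at nonnegative places and
    \<open>Y\<close> the holes at negative ones. The place leaving the negative half holds a
    particle iff \<open>0 \<notin> Y\<close>. The weight drops by \<open>card Y - card X\<close>,
    which is \<open>Suc k\<close>.\<close>
  let ?f = "\<lambda>(X, Y). (push (0 \<notin> Y) X, pred_set Y)"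
  let ?g = "\<lambda>(X, Y). (pred_set X, push (0 \<notin> X) Y)"
  have "?f (X, Y) \<in> pairs k 0 (N - int (Suc k))" if "(X, Y) \<in> pairs (Suc k) 0 N" for X Y
  proof -
    obtain b Z where "Y = push b Z" using push_pred_set[of Y] by metis
    with that show ?thesis by (auto simp: pairs_def simp del: of_nat_sum)
  qed
  moreover have "?g (X, Y) \<in> pairs (Suc k) 0 N" if "(X, Y) \<in> pairs k 0 (N - int (Suc k))" for X Y
  proof -
    obtain b Z where "X = push b Z" using push_pred_set[of X] by metis
    with that show ?thesis by (auto simp: pairs_def simp del: of_nat_sum)
  qed
  ultimately show "bij_betw ?f (pairs (Suc k) 0 N) (pairs k 0 (N - int (Suc k)))"
    by (intro bij_betw_byWitness[where f' = ?g]) (auto simp: push_pred_set)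
qed

text \<open>Translating down to charge zero costs \<open>k\<close>, then \<open>k - 1\<close>, and
  so on to \<open>1\<close>.\<close>

lemma card_pairs: "card (pairs k a N) = card (pairs 0 0 (N - int (\<Sum>{..k})))"
proof -
  have "card (pairs k a N) = card (pairs k 0 N)"
    by (induction a) (simp_all add: card_pairs_shift_left)
  also have "\<dots> = card (pairs 0 0 (N - int (\<Sum>{..k})))"
    by (induction k arbitrary: N)
      (simp_all add: card_pairs_shift_charge diff_diff_eq ac_simps del: of_nat_sum)
  finally show ?thesis .
qed

text \<open>The reflections add \<open>a + 1, ..., a + m\<close> to the weight and leave excess
  \<open>k + 2 * m\<close> with no pattern left; \<open>card_pairs\<close> finishes. The bound on
  \<open>a\<close> survives since \<open>a\<close> grows by one while \<open>k\<close> grows by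
  two.\<close>

lemma card_alt_pairs:
  assumes "a \<le> Suc k"
  shows "card (alt_pairs m k a N) =
    card (pairs 0 0 (N + int (a * m) + int (\<Sum>{..m}) - int (\<Sum>{..k + 2 * m})))"
  using assms
proof (induction m arbitrary: k a N)
  case 0
  have "alt_pairs 0 k a N = pairs k a N" by (auto simp: alt_pairs_def)
  then show ?case by (simp add: card_pairs[of k a])
next
  case (Suc m)
  have "card (alt_pairs (Suc m) k a N) = card (alt_pairs m (k + 2) (Suc a) (N + int a + 1))"
    using Suc.prems by (rule card_alt_pairs_Suc)
  also have "\<dots> = card (pairs 0 0 (N + int a + 1 + int (Suc a * m) + int (\<Sum>{..m}) -
      int (\<Sum>{..k + 2 + 2 * m})))"
    by (rule Suc.IH) (use Suc.prems in linarith)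
  also have "k + 2 + 2 * m = k + 2 * Suc m" by simp
  also have "N + int a + 1 + int (Suc a * m) + int (\<Sum>{..m}) =
      N + int (a * Suc m) + int (\<Sum>{..Suc m})"
    by simp
  finally show ?case .
qed

section \<open>The Frobenius symbol\<close>

definition part_list :: "nat list \<Rightarrow> bool" where
  "part_list xs \<longleftrightarrow> sorted (rev xs) \<and> (\<forall>x\<in>set xs. 0 < x)"

lemma partitions_of_iff: "xs \<in> partitions_of n \<longleftrightarrow> part_list xs \<and> sum_list xs = n"
  by (auto simp: partitions_of_def is_partition_def part_list_def)

text \<open>Deleting the first column makes the rows of length one vanish, so their number
  \<open>k\<close> is kept separately.\<close>

lemma tail_decomposition:
  assumes "sorted (rev rest)" "\<forall>x\<in>set rest. 0 < x"
  shows "\<exists>mu k. rest = map Suc mu @ replicate k 1 \<and> sorted (rev mu) \<and> (\<forall>x\<in>set mu. 0 < x)"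
  using assms
proof (induction rest)
  case (Cons z rest)
  then have z: "\<forall>x\<in>set rest. x \<le> z" "0 < z" by (auto simp: sorted_append)
  obtain mu k where mk: "rest = map Suc mu @ replicate k 1" "sorted (rev mu)" "\<forall>x\<in>set mu. 0 < x"
  proof -
    have "sorted (rev rest)" "\<forall>x\<in>set rest. 0 < x" using Cons.prems by (auto simp: sorted_append)
    from Cons.IH[OF this] that show thesis by blast
  qed
  show ?case
  proof (cases "z = 1")
    case True
    with z mk have "mu = []" by (cases mu) auto
    with True mk have "z # rest = map Suc [] @ replicate (Suc k) 1" by simp
    then show ?thesis by (metis empty_iff empty_set rev.simps(1) sorted_wrt.simps(1))
  next
    case False
    then obtain w where "z = Suc w" "0 < w" using z(2) by (cases z) auto
    with z mk have "z # rest = map Suc (w # mu) @ replicate k 1"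
      "sorted (rev (w # mu))" "\<forall>x\<in>set (w # mu). 0 < x" by (auto simp: sorted_append)
    then show ?thesis by blast
  qed
qed simp

text \<open>\<open>r\<close> is the length of the first row, \<open>mu\<close> what remains after deleting the first hook, and \<open>k\<close> the
  number of cells of the first column below \<open>mu\<close>.\<close>

definition add_hook :: "nat \<Rightarrow> nat list \<Rightarrow> nat \<Rightarrow> nat list" where
  "add_hook r mu k = r # map Suc mu @ replicate k 1"

lemma part_list_add_hook:
  "part_list mu \<Longrightarrow> 0 < r \<Longrightarrow> (\<forall>z\<in>set mu. z < r) \<Longrightarrow> part_list (add_hook r mu k)"
proof -
  assume "part_list mu" "0 < r" and r: "\<forall>z\<in>set mu. z < r"
  then have "sorted (map Suc (rev mu))" by (simp add: part_list_def sorted_map)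
  then show ?thesis using r \<open>0 < r\<close>
    by (auto simp: part_list_def add_hook_def sorted_append rev_map Suc_le_eq)
qed

lemma part_list_cases:
  assumes "part_list xs"
  obtains "xs = []"
  | r mu k where "xs = add_hook r mu k" "part_list mu" "0 < r" "\<forall>z\<in>set mu. z < r"
proof (cases xs)
  case (Cons r rest)
  then have *: "sorted (rev rest)" "\<forall>x\<in>set rest. 0 < x" "0 < r" "\<forall>x\<in>set rest. x \<le> r"
    using assms by (auto simp: part_list_def sorted_append)
  obtain mu k where "rest = map Suc mu @ replicate k 1" "sorted (rev mu)" "\<forall>x\<in>set mu. 0 < x"
    using tail_decomposition[OF *(1,2)] by blast
  with * Cons have "xs = add_hook r mu k" "part_list mu" "0 < r" "\<forall>z\<in>set mu. z < r"
    by (simp_all add: add_hook_def part_list_def ball_Un Suc_le_eq)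
  then show thesis by (rule that(2))
qed (use that in simp)

text \<open>Induction on the Frobenius symbol: removing the outermost hook deletes the first column
  of the symbol.\<close>

lemma part_list_induct [consumes 1, case_names Nil hook]:
  assumes "part_list xs" "P []"
    "\<And>r mu k. part_list mu \<Longrightarrow> 0 < r \<Longrightarrow> \<forall>z\<in>set mu. z < r \<Longrightarrow> P mu \<Longrightarrow> P (add_hook r mu k)"
  shows "P xs"
  using assms(1)
proof (induction "length xs" arbitrary: xs rule: less_induct)
  case less
  from less.prems show ?case
  proof (cases rule: part_list_cases)
    case (2 r mu k)
    then show ?thesis using less.hyps[of mu] assms(3) by (simp add: add_hook_def)
  qed (use assms(2) in simp)
qed

lemma length_add_hook [simp]: "length (add_hook r mu k) = Suc (length mu + k)"
  by (simp add: add_hook_def)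

lemma part_1: "part (add_hook r mu k) (Suc 0) = r"
  by (simp add: part_def add_hook_def)

lemma part_Suc:
  assumes "1 \<le> i"
  shows "part (add_hook r mu k) (Suc i) =
    (if i \<le> length mu then Suc (part mu i) else if i \<le> length mu + k then 1 else 0)"
  using assms by (cases i) (auto simp: part_def add_hook_def nth_append)

lemma part_antimono:
  assumes "part_list xs" "1 \<le> i" "i \<le> j"
  shows "part xs j \<le> part xs i"
proof -
  have "xs ! (j - 1) \<le> xs ! (i - 1)" if "j \<le> length xs"
    using assms that sorted_rev_nth_mono[of xs "i - 1" "j - 1"] by (auto simp: part_list_def)
  then show ?thesis using assms by (auto simp: part_def)
qed

definition diag_set :: "nat list \<Rightarrow> nat set" where
  "diag_set xs = {i. 1 \<le> i \<and> i \<le> length xs \<and> i \<le> part xs i}"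

lemma diag_eq: "diag xs = card (diag_set xs)"
  by (simp add: diag_def diag_set_def)

lemma diag_set_add_hook:
  assumes "0 < r"
  shows "diag_set (add_hook r mu k) = insert 1 (Suc ` diag_set mu)"
proof -
  have "i \<in> diag_set (add_hook r mu k) \<longleftrightarrow> i \<in> insert 1 (Suc ` diag_set mu)" for i
  proof (cases "i \<le> 1")
    case True
    then show ?thesis using assms by (cases i) (auto simp: diag_set_def part_1 add_hook_def part_def)
  next
    case False
    then obtain j where "i = Suc j" "1 \<le> j" by (cases i) auto
    then show ?thesis by (auto simp: diag_set_def part_Suc image_iff)
  qed
  then show ?thesis by blast
qed

text \<open>\<open>diag\<close> only counts indices. That they form an initial segment turns
  \<open>i \<le> diag xs\<close> into a statement about the cell \<open>(i, i)\<close>.\<close>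

lemma diag_set: "part_list xs \<Longrightarrow> diag_set xs = {1..diag xs}"
proof (induction rule: part_list_induct)
  case Nil
  then show ?case by (simp add: diag_set_def diag_def)
next
  case (hook r mu k)
  have "diag_set (add_hook r mu k) = {1..Suc (diag mu)}"
    unfolding diag_set_add_hook[OF hook(2)] hook(4) by (auto simp: image_Suc_atLeastAtMost)
  then show ?case by (simp add: diag_eq)
qed

lemma diag_add_hook: "part_list mu \<Longrightarrow> 0 < r \<Longrightarrow> diag (add_hook r mu k) = Suc (diag mu)"
proof -
  assume "part_list mu" "0 < r"
  then have "diag_set (add_hook r mu k) = {1..Suc (diag mu)}"
    by (auto simp: diag_set_add_hook diag_set image_Suc_atLeastAtMost)
  then show ?thesis by (simp add: diag_eq)
qed

lemma le_diag:
  assumes "part_list xs" "1 \<le> i" "i \<le> diag xs"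
  shows "i \<le> length xs" "i \<le> part xs i"
proof -
  have "i \<in> diag_set xs" using assms by (simp add: diag_set)
  then show "i \<le> length xs" "i \<le> part xs i" by (simp_all add: diag_set_def)
qed

lemma conj_part_antimono: "i \<le> j \<Longrightarrow> conj_part xs j \<le> conj_part xs i"
  unfolding conj_part_def by (rule card_mono) auto

lemma le_conj_part:
  assumes "part_list xs" "1 \<le> i" "i \<le> diag xs"
  shows "i \<le> conj_part xs i"
proof -
  have "{1..i} \<subseteq> {j. 1 \<le> j \<and> j \<le> length xs \<and> i \<le> part xs j}"
    using le_diag[OF assms] part_antimono[OF assms(1), of _ i] by force
  then have "card {1..i} \<le> conj_part xs i" unfolding conj_part_def by (intro card_mono) auto
  then show ?thesis by simp
qed

lemma part_le: "\<forall>z\<in>set xs. z < r \<Longrightarrow> 0 < r \<Longrightarrow> part xs i < r"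
  by (auto simp: part_def)

lemma part_pos: "part_list xs \<Longrightarrow> 1 \<le> i \<Longrightarrow> i \<le> length xs \<Longrightarrow> 1 \<le> part xs i"
  by (auto simp: part_def part_list_def Suc_le_eq)

lemma conj_part_1: "part_list xs \<Longrightarrow> conj_part xs 1 = length xs"
proof -
  assume "part_list xs"
  then have "{j. 1 \<le> j \<and> j \<le> length xs \<and> 1 \<le> part xs j} = {1..length xs}"
    by (auto dest: part_pos)
  then show ?thesis by (simp add: conj_part_def)
qed

text \<open>As \<open>i < r\<close>, the first row reaches column \<open>Suc i\<close> and
  contributes one cell; the \<open>k\<close> rows of length one do not reach it.\<close>

lemma conj_part_Suc:
  assumes "1 \<le> i" "i < r"
  shows "conj_part (add_hook r mu k) (Suc i) = Suc (conj_part mu i)"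
proof -
  let ?A = "{j. 1 \<le> j \<and> j \<le> length mu \<and> i \<le> part mu j}"
  have "j \<in> {j. 1 \<le> j \<and> j \<le> length (add_hook r mu k) \<and> Suc i \<le> part (add_hook r mu k) j}
    \<longleftrightarrow> j \<in> insert 1 (Suc ` ?A)" for j
  proof (cases "j \<le> 1")
    case True
    then show ?thesis using assms by (cases j) (auto simp: part_1 add_hook_def part_def)
  next
    case False
    then obtain l where "j = Suc l" "1 \<le> l" by (cases j) auto
    then show ?thesis using assms by (auto simp: part_Suc image_iff)
  qed
  then have "conj_part (add_hook r mu k) (Suc i) = card (insert 1 (Suc ` ?A))"
    unfolding conj_part_def by (intro arg_cong[of _ _ card]) blast
  also have "\<dots> = Suc (card (Suc ` ?A))" by (rule card_insert_disjoint) auto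
  also have "\<dots> = Suc (conj_part mu i)" by (simp add: card_image conj_part_def)
  finally show ?thesis .
qed

text \<open>Natural-number Frobenius entries; for diagonal indices the subtraction does not
  truncate, by \<open>frob_arm_leg\<close>.\<close>

definition arm :: "nat list \<Rightarrow> nat \<Rightarrow> nat" where
  "arm xs i = part xs i - i"

definition leg :: "nat list \<Rightarrow> nat \<Rightarrow> nat" where
  "leg xs i = conj_part xs i - i"

lemma frob_arm_leg:
  assumes "part_list xs" "i \<in> {1..diag xs}"
  shows "frob_x xs i = int (arm xs i)" "frob_y xs i = int (leg xs i)"
  using le_diag[of xs i] le_conj_part[of xs i] assms
  by (auto simp: frob_x_def frob_y_def arm_def leg_def)

text \<open>Row and column lengths weakly decrease while the subtracted index grows. Hence the set
  of entries determines their order.\<close>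

lemma arm_leg_less:
  assumes "part_list xs" "1 \<le> i" "i < j" "j \<le> diag xs"
  shows "arm xs j < arm xs i" "leg xs j < leg xs i"
  using le_diag[of xs j] le_conj_part[of xs j] part_antimono[of xs i j] conj_part_antimono[of i j xs]
    assms by (auto simp: arm_def leg_def)

lemma arm_leg_add_hook:
  assumes "part_list mu" "0 < r" "\<forall>z\<in>set mu. z < r"
  shows "arm (add_hook r mu k) 1 = r - 1" "leg (add_hook r mu k) 1 = length mu + k"
    "i \<in> {1..diag mu} \<Longrightarrow> arm (add_hook r mu k) (Suc i) = arm mu i"
    "i \<in> {1..diag mu} \<Longrightarrow> leg (add_hook r mu k) (Suc i) = leg mu i"
proof -
  show "arm (add_hook r mu k) 1 = r - 1" by (simp add: arm_def part_1)
  have "conj_part (add_hook r mu k) 1 = length (add_hook r mu k)"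
    by (rule conj_part_1[OF part_list_add_hook[OF assms]])
  then show "leg (add_hook r mu k) 1 = length mu + k" by (simp add: leg_def add_hook_def)
  assume i: "i \<in> {1..diag mu}"
  then show "arm (add_hook r mu k) (Suc i) = arm mu i"
    using le_diag[of mu i] assms by (simp add: arm_def part_Suc)
  have "i < r" using i le_diag[of mu i] part_le[of mu r i] assms by auto
  then show "leg (add_hook r mu k) (Suc i) = leg mu i"
    using i by (simp add: leg_def conj_part_Suc)
qed

section \<open>The Frobenius bijection\<close>

definition arms :: "nat list \<Rightarrow> nat set" where "arms xs = arm xs ` {1..diag xs}"
definition legs :: "nat list \<Rightarrow> nat set" where "legs xs = leg xs ` {1..diag xs}"

lemma finite_arms_legs [simp]: "finite (arms xs)" "finite (legs xs)"
  by (simp_all add: arms_def legs_def)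

lemma arms_legs_Nil [simp]: "arms [] = {}" "legs [] = {}"
  by (simp_all add: arms_def legs_def diag_def)

lemma arms_legs_add_hook:
  assumes "part_list mu" "0 < r" "\<forall>z\<in>set mu. z < r"
  shows "arms (add_hook r mu k) = insert (r - 1) (arms mu)"
    "legs (add_hook r mu k) = insert (length mu + k) (legs mu)"
proof -
  have *: "{1..Suc n} = insert 1 (Suc ` {1..n})" for n
    by (auto simp: image_Suc_atLeastAtMost)
  have "(\<lambda>i. arm (add_hook r mu k) (Suc i)) ` {1..diag mu} = arm mu ` {1..diag mu}"
    "(\<lambda>i. leg (add_hook r mu k) (Suc i)) ` {1..diag mu} = leg mu ` {1..diag mu}"
    by (rule image_cong[OF refl], rule arm_leg_add_hook[OF assms], assumption)+
  then show "arms (add_hook r mu k) = insert (r - 1) (arms mu)"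
    "legs (add_hook r mu k) = insert (length mu + k) (legs mu)"
    unfolding arms_def legs_def diag_add_hook[OF assms(1,2)] *
    by (simp_all only: image_insert image_image arm_leg_add_hook(1,2)[OF assms])
qed

text \<open>The entries of an added hook exceed all others, so they are new and are the maxima of
  the enlarged sets.\<close>

lemma arms_legs_bound:
  assumes "part_list mu"
  shows "0 < r \<Longrightarrow> \<forall>z\<in>set mu. z < r \<Longrightarrow> \<forall>x\<in>arms mu. x < r - 1" "\<forall>y\<in>legs mu. y < length mu"
proof -
  assume r: "0 < r" "\<forall>z\<in>set mu. z < r"
  show "\<forall>x\<in>arms mu. x < r - 1"
  proof
    fix x assume "x \<in> arms mu"
    then obtain i where i: "1 \<le> i" "i \<le> diag mu" "x = part mu i - i"
      by (auto simp: arms_def arm_def)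
    then show "x < r - 1"
      using le_diag[OF assms i(1,2)] part_le[OF r(2,1), of i] by linarith
  qed
next
  show "\<forall>y\<in>legs mu. y < length mu"
  proof
    fix y assume "y \<in> legs mu"
    then obtain i where i: "1 \<le> i" "i \<le> diag mu" "y = leg mu i" by (auto simp: legs_def)
    then show "y < length mu"
      using conj_part_antimono[of 1 i mu] conj_part_1[OF assms] le_diag[OF assms, of i]
      by (auto simp: leg_def)
  qed
qed

lemma card_arms_legs:
  assumes "part_list xs"
  shows "card (arms xs) = diag xs" "card (legs xs) = diag xs"
proof -
  have "inj_on (arm xs) {1..diag xs}" "inj_on (leg xs) {1..diag xs}"
    using arm_leg_less[OF assms] by (auto intro!: linorder_inj_onI' simp: less_le)
      (metis nat_neq_iff)+
  then show "card (arms xs) = diag xs" "card (legs xs) = diag xs"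
    by (simp_all add: arms_def legs_def card_image)
qed

text \<open>Each hook consists of its arm, its leg and its corner; \<open>card (legs xs)\<close>
  counts the corners.\<close>

lemma sum_list_eq_arms_legs:
  "part_list xs \<Longrightarrow> sum_list xs = \<Sum>(arms xs) + \<Sum>(legs xs) + card (legs xs)"
proof (induction rule: part_list_induct)
  case (hook r mu k)
  have "r - 1 \<notin> arms mu" "length mu + k \<notin> legs mu"
    using arms_legs_bound(1)[OF hook(1-3)] arms_legs_bound(2)[OF hook(1)] by auto
  moreover have "sum_list (map Suc mu) = sum_list mu + length mu" by (induction mu) auto
  ultimately show ?case using hook
    by (simp add: arms_legs_add_hook) (simp add: add_hook_def sum_list_replicate)
qed simp

text \<open>The outermost hook is recovered from the maxima of the two sets, and induction handles
  what lies inside it.\<close>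

lemma arms_legs_inj:
  assumes "part_list xs" "part_list xs'" "arms xs = arms xs'" "legs xs = legs xs'"
  shows "xs = xs'"
  using assms
proof (induction arbitrary: xs' rule: part_list_induct)
  case Nil
  from Nil(1) show ?case
    by (cases rule: part_list_cases) (use Nil in \<open>auto simp: arms_legs_add_hook\<close>)
next
  case (hook r mu k)
  from hook(5) show ?case
  proof (cases rule: part_list_cases)
    case 1
    then show ?thesis using hook by (auto simp: arms_legs_add_hook)
  next
    case (2 r' mu' k')
    have b: "\<forall>x\<in>arms mu. x < r - 1" "\<forall>y\<in>legs mu. y < length mu + k"
      "\<forall>x\<in>arms mu'. x < r' - 1" "\<forall>y\<in>legs mu'. y < length mu' + k'"
      using arms_legs_bound(1)[OF hook(1-3)] arms_legs_bound(2)[OF hook(1)]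
        arms_legs_bound(1)[OF 2(2-4)] arms_legs_bound(2)[OF 2(2)] by (auto intro: trans_less_add1)
    have top: "a = b \<and> A = B" if "insert a A = insert b B" "\<forall>x\<in>A. x < a" "\<forall>x\<in>B. x < b"
      for a b :: nat and A B
    proof -
      have "a = b" using that by (metis insertCI insertE less_asym)
      then show ?thesis using that by (metis insert_ident less_irrefl)
    qed
    have eqs: "insert (r - 1) (arms mu) = insert (r' - 1) (arms mu')"
      "insert (length mu + k) (legs mu) = insert (length mu' + k') (legs mu')"
      using hook 2 by (simp_all add: arms_legs_add_hook)
    note tops = top[OF eqs(1) b(1,3)] top[OF eqs(2) b(2,4)]
    then have "mu = mu'" using hook(4) 2(2) by blast
    moreover from this have "k = k'" using tops by simp
    moreover have "r = r'" using tops hook(2) 2(3) by linarith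
    ultimately show ?thesis using 2(1) by simp
  qed
qed

lemma arms_legs_surj:
  assumes "finite X" "finite Y" "card X = card Y"
  shows "\<exists>xs. part_list xs \<and> arms xs = X \<and> legs xs = Y"
  using assms
proof (induction "card X" arbitrary: X Y)
  case 0
  then have "X = {}" "Y = {}" by auto
  then show ?case by (intro exI[of _ "[]"]) (simp add: part_list_def)
next
  case (Suc d)
  then have ne: "X \<noteq> {}" "Y \<noteq> {}" by auto
  define x y where "x = Max X" and "y = Max Y"
  have xy: "x \<in> X" "y \<in> Y" using ne Suc by (auto simp: x_def y_def)
  have lt: "\<forall>a\<in>X - {x}. a < x" "\<forall>b\<in>Y - {y}. b < y"
    using Suc by (auto simp: x_def y_def less_le)
  have "d = card (X - {x})" "card (X - {x}) = card (Y - {y})"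
    using xy Suc.hyps(2) Suc.prems by simp_all
  then obtain mu where mu: "part_list mu" "arms mu = X - {x}" "legs mu = Y - {y}"
    using Suc.hyps(1)[of "X - {x}" "Y - {y}"] Suc.prems by auto
  \<comment> \<open>The hook fits around \<open>mu\<close>: the arms of \<open>mu\<close> are below
    \<open>x\<close>, so its rows have length at most \<open>x\<close>; its legs are below
    \<open>y\<close>, so it has at most \<open>y\<close> rows.\<close>
  have "(\<forall>z\<in>set mu. z < Suc x) \<and> length mu \<le> y"
    using mu(1)
  proof (cases rule: part_list_cases)
    case (2 r nu k)
    then have "r - 1 \<in> arms mu" "length nu + k \<in> legs mu" by (simp_all add: arms_legs_add_hook)
    then have "r - 1 < x" "length nu + k < y" using lt mu by auto
    moreover have "\<forall>z\<in>set mu. z \<le> r" using 2 by (auto simp: add_hook_def)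
    ultimately show ?thesis using 2 by (fastforce simp: add_hook_def)
  qed simp
  then have "part_list (add_hook (Suc x) mu (y - length mu))"
    "arms (add_hook (Suc x) mu (y - length mu)) = X"
    "legs (add_hook (Suc x) mu (y - length mu)) = Y"
    using mu xy by (auto simp: arms_legs_add_hook intro: part_list_add_hook)
  then show ?case by blast
qed

lemma bij_betw_arms_legs:
  "bij_betw (\<lambda>xs. (arms xs, legs xs)) (partitions_of n) (pairs 0 0 (int n))"
proof (rule bij_betwI')
  show "((arms xs, legs xs) = (arms ys, legs ys)) = (xs = ys)"
    if "xs \<in> partitions_of n" "ys \<in> partitions_of n" for xs ys
    using that arms_legs_inj by (auto simp: partitions_of_iff)
  show "(arms xs, legs xs) \<in> pairs 0 0 (int n)" if "xs \<in> partitions_of n" for xs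
    using that sum_list_eq_arms_legs[of xs]
    by (auto simp: partitions_of_iff pairs_def card_arms_legs simp del: of_nat_sum)
  show "\<exists>xs\<in>partitions_of n. p = (arms xs, legs xs)" if "p \<in> pairs 0 0 (int n)" for p
  proof -
    obtain X Y where XY: "p = (X, Y)" by force
    then have p: "finite X" "finite Y" "card X = card Y" "\<Sum>X + \<Sum>Y + card Y = n"
      using that by (simp_all add: pairs_def flip: of_nat_sum of_nat_add)
    obtain xs where "part_list xs" "arms xs = X" "legs xs = Y"
      using arms_legs_surj[OF p(1-3)] by blast
    then show ?thesis using XY p sum_list_eq_arms_legs[of xs]
      by (intro bexI[of _ xs]) (auto simp: partitions_of_iff)
  qed
qed

lemma card_pairs_0: "int (card (pairs 0 0 N)) = pcount N"
proof (cases "N < 0")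
  case True
  then have "pairs 0 0 N = {}" by (auto simp: pairs_def simp del: of_nat_sum)
  with True show ?thesis by (simp add: pcount_def)
next
  case False
  then show ?thesis
    using bij_betw_same_card[OF bij_betw_arms_legs[of "nat N"]] by (simp add: pcount_def)
qed

text \<open>The triangular numbers of \<open>2 * m\<close> and \<open>m\<close> differ by a
  generalized pentagonal number. The bound on \<open>a\<close> is that of
  \<open>card_alt_pairs\<close> at charge zero.\<close>

lemma card_alt_pairs_eq_pcount:
  assumes "a \<le> 1"
  shows "int (card (alt_pairs m 0 a (int n))) =
    pcount (int n + int (a * m) - (3 * int m ^ 2 + int m) div 2)"
proof -
  have tri: "2 * int (\<Sum>{..k}) = int k * (int k + 1)" for k
    by (induction k) (simp_all add: algebra_simps)
  have "3 * int m ^ 2 + int m = 2 * (int (\<Sum>{..2 * m}) - int (\<Sum>{..m}))"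
    using tri[of m] tri[of "2 * m"] by (simp add: algebra_simps power2_eq_square del: of_nat_sum)
  then have "(3 * int m ^ 2 + int m) div 2 = int (\<Sum>{..2 * m}) - int (\<Sum>{..m})" by simp
  then show ?thesis
    using card_alt_pairs[of a 0 m "int n"] assms
    by (simp add: card_pairs_0 del: of_nat_sum) (simp add: algebra_simps del: of_nat_sum)
qed

section \<open>Alternating columns\<close>

text \<open>The indices are chosen from right to left, \<open>b\<close> being the sign of the
  rightmost one.\<close>

fun chain :: "(nat \<Rightarrow> bool) \<Rightarrow> bool \<Rightarrow> nat \<Rightarrow> nat \<Rightarrow> bool" where
  "chain \<sigma> b 0 d = True"
| "chain \<sigma> b (Suc m) d = (\<exists>i\<in>{1..d}. \<sigma> i = b \<and> chain \<sigma> (\<not> b) m (i - 1))"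

lemma chain_mono: "chain \<sigma> b m d \<Longrightarrow> d \<le> e \<Longrightarrow> chain \<sigma> b m e"
  by (cases m) fastforce+

text \<open>The rightmost chosen index has sign \<open>b\<close> and bounds all others, so only
  indices of sign \<open>b\<close> have to stay below \<open>e\<close>.\<close>

lemma chain_restrict:
  assumes "chain \<sigma> b m d" "\<And>j. 1 \<le> j \<Longrightarrow> j \<le> d \<Longrightarrow> \<sigma> j = b \<Longrightarrow> j \<le> e"
  shows "chain \<sigma> b m e"
  using assms by (cases m) fastforce+

text \<open>A \<open>True\<close> step at \<open>v\<close> makes column \<open>upcount X v\<close>
  positive, since its leg is below \<open>v\<close> and its arm is not. A \<open>False\<close> step
  makes column \<open>upcount Y v\<close> negative. Conversely, a positive column is seen at the
  level of its arm, a negative one at that of its leg.\<close>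

lemma alternates_iff_chain:
  fixes x y :: "nat \<Rightarrow> nat" and \<sigma> :: "nat \<Rightarrow> bool"
  assumes dec: "\<And>i j. 1 \<le> i \<Longrightarrow> i < j \<Longrightarrow> j \<le> d \<Longrightarrow> x j < x i \<and> y j < y i"
    and sgn: "\<And>i. 1 \<le> i \<Longrightarrow> i \<le> d \<Longrightarrow> \<sigma> i \<longleftrightarrow> y i < x i"
  defines "X \<equiv> x ` {1..d}" and "Y \<equiv> y ` {1..d}"
  shows "alternates True m X Y u \<longleftrightarrow> chain \<sigma> True m (upcount X u)"
    and "alternates False m X Y u \<longleftrightarrow> chain \<sigma> False m (upcount Y u)"
proof -
  \<comment> \<open>For a strictly decreasing \<open>z\<close> the indices with value at least
    \<open>v\<close> form an initial segment, of length \<open>upcount\<close>.\<close>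
  have count: "i \<le> upcount (z ` {1..d}) v \<longleftrightarrow> v \<le> z i"
    if z: "\<And>i j. 1 \<le> i \<Longrightarrow> i < j \<Longrightarrow> j \<le> d \<Longrightarrow> z j < z i" and i: "1 \<le> i" "i \<le> d"
    for z :: "nat \<Rightarrow> nat" and v i
  proof -
    have inj: "inj_on z {1..d}"
      by (rule inj_onI) (metis atLeastAtMost_iff less_irrefl linorder_neqE_nat z)
    have "{w \<in> z ` {1..d}. v \<le> w} = z ` {j \<in> {1..d}. v \<le> z j}" by auto
    then have c: "upcount (z ` {1..d}) v = card {j \<in> {1..d}. v \<le> z j}"
      unfolding upcount_def by (simp only:) (rule card_image[OF inj_on_subset[OF inj]], auto)
    show ?thesis
    proof
      assume v: "v \<le> z i"
      have "{1..i} \<subseteq> {j \<in> {1..d}. v \<le> z j}"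
      proof
        fix j assume j: "j \<in> {1..i}"
        with v z[of j i] i show "j \<in> {j \<in> {1..d}. v \<le> z j}" by (cases "j = i") auto
      qed
      then have "card {1..i} \<le> upcount (z ` {1..d}) v"
        unfolding c by (intro card_mono) auto
      then show "i \<le> upcount (z ` {1..d}) v" by simp
    next
      assume le: "i \<le> upcount (z ` {1..d}) v"
      show "v \<le> z i"
      proof (rule ccontr)
        assume n: "\<not> v \<le> z i"
        have "{j \<in> {1..d}. v \<le> z j} \<subseteq> {1..<i}"
        proof
          fix j assume j: "j \<in> {j \<in> {1..d}. v \<le> z j}"
          with n z[of i j] i show "j \<in> {1..<i}" by (cases "i < j"; cases "i = j") auto
        qed
        then have "card {j \<in> {1..d}. v \<le> z j} \<le> card {1..<i}" by (intro card_mono) auto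
        with le i show False unfolding c by simp
      qed
    qed
  qed
  have le_d: "upcount (z ` {1..d}) v \<le> d" for z v
  proof -
    have "upcount (z ` {1..d}) v \<le> card (z ` {1..d})"
      unfolding upcount_def by (rule card_mono) auto
    also have "\<dots> \<le> d" using card_image_le[of "{1..d}" z] by simp
    finally show ?thesis .
  qed
  have cx: "i \<le> upcount X v \<longleftrightarrow> v \<le> x i" and cy: "i \<le> upcount Y v \<longleftrightarrow> v \<le> y i"
    if "1 \<le> i" "i \<le> d" for i v
    using count[of x i v] count[of y i v] dec that by (simp_all add: X_def Y_def)
  have dX: "upcount X v \<le> d" and dY: "upcount Y v \<le> d" for v
    using le_d by (simp_all add: X_def Y_def)
  have "(alternates True m X Y u \<longleftrightarrow> chain \<sigma> True m (upcount X u)) \<and>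
    (alternates False m X Y u \<longleftrightarrow> chain \<sigma> False m (upcount Y u))" for u
  proof (induction m arbitrary: u)
    case (Suc m)
    have "alternates True (Suc m) X Y u \<longleftrightarrow>
        (\<exists>v\<ge>u. upcount Y v < upcount X v \<and> chain \<sigma> False m (upcount Y v))"
      using Suc.IH by simp
    also have "\<dots> \<longleftrightarrow> (\<exists>i\<in>{1..upcount X u}. \<sigma> i \<and> chain \<sigma> False m (i - 1))"
    proof
      assume "\<exists>v\<ge>u. upcount Y v < upcount X v \<and> chain \<sigma> False m (upcount Y v)"
      then obtain v where v: "u \<le> v" "upcount Y v < upcount X v" "chain \<sigma> False m (upcount Y v)"
        by blast
      let ?i = "upcount X v"
      have i: "1 \<le> ?i" "?i \<le> d" "v \<le> x ?i" "\<not> v \<le> y ?i"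
        using v dX cx[of ?i v] cy[of ?i v] by auto
      then have "\<sigma> ?i" "?i \<le> upcount X u" using sgn[of ?i] cx[of ?i u] v by auto
      moreover have "chain \<sigma> False m (?i - 1)" using v by (auto intro: chain_mono)
      ultimately show "\<exists>i\<in>{1..upcount X u}. \<sigma> i \<and> chain \<sigma> False m (i - 1)" using i by auto
    next
      assume "\<exists>i\<in>{1..upcount X u}. \<sigma> i \<and> chain \<sigma> False m (i - 1)"
      then obtain i where i: "1 \<le> i" "i \<le> upcount X u" "\<sigma> i" "chain \<sigma> False m (i - 1)" by auto
      then have id: "i \<le> d" using dX le_trans by blast
      have "y i < x i" "u \<le> x i" using sgn[of i] cx[of i u] i id by auto
      then have "upcount Y (x i) < i" "i \<le> upcount X (x i)"
        using cy[of i "x i"] cx[of i "x i"] i id by auto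
      \<comment> \<open>A negative column \<open>j < i\<close> satisfies
        \<open>x i < x j \<le> y j\<close>, so it is counted at level \<open>x i\<close>.\<close>
      moreover have "chain \<sigma> False m (upcount Y (x i))"
        using i(4)
      proof (rule chain_restrict)
        fix j assume "1 \<le> j" "j \<le> i - 1" "\<sigma> j = False"
        then have "1 \<le> j" "j < i" "j \<le> d" "\<not> \<sigma> j" using i(1) id by auto
        then show "j \<le> upcount Y (x i)" using sgn[of j] dec[of j i] cy[of j "x i"] id i(1) by auto
      qed
      ultimately show "\<exists>v\<ge>u. upcount Y v < upcount X v \<and> chain \<sigma> False m (upcount Y v)"
        using \<open>u \<le> x i\<close> by (intro exI[of _ "x i"]) auto
    qed
    finally have 1: "alternates True (Suc m) X Y u \<longleftrightarrow> chain \<sigma> True (Suc m) (upcount X u)" by simp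
    have "alternates False (Suc m) X Y u \<longleftrightarrow>
        (\<exists>v\<ge>u. upcount X (Suc v) < upcount Y v \<and> chain \<sigma> True m (upcount X (Suc v)))"
      using Suc.IH by simp
    also have "\<dots> \<longleftrightarrow> (\<exists>i\<in>{1..upcount Y u}. \<not> \<sigma> i \<and> chain \<sigma> True m (i - 1))"
    proof
      assume "\<exists>v\<ge>u. upcount X (Suc v) < upcount Y v \<and> chain \<sigma> True m (upcount X (Suc v))"
      then obtain v where v: "u \<le> v" "upcount X (Suc v) < upcount Y v"
        "chain \<sigma> True m (upcount X (Suc v))"
        by blast
      let ?i = "upcount Y v"
      have i: "1 \<le> ?i" "?i \<le> d" "v \<le> y ?i" "\<not> Suc v \<le> x ?i"
        using v dY cy[of ?i v] cx[of ?i "Suc v"] by auto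
      then have "\<not> \<sigma> ?i" "?i \<le> upcount Y u" using sgn[of ?i] cy[of ?i u] v by auto
      moreover have "chain \<sigma> True m (?i - 1)" using v by (auto intro: chain_mono)
      ultimately show "\<exists>i\<in>{1..upcount Y u}. \<not> \<sigma> i \<and> chain \<sigma> True m (i - 1)" using i by auto
    next
      assume "\<exists>i\<in>{1..upcount Y u}. \<not> \<sigma> i \<and> chain \<sigma> True m (i - 1)"
      then obtain i where i: "1 \<le> i" "i \<le> upcount Y u" "\<not> \<sigma> i" "chain \<sigma> True m (i - 1)" by auto
      then have id: "i \<le> d" using dY le_trans by blast
      have "x i \<le> y i" "u \<le> y i" using sgn[of i] cy[of i u] i id by auto
      then have "upcount X (Suc (y i)) < i" "i \<le> upcount Y (y i)"
        using cx[of i "Suc (y i)"] cy[of i "y i"] i id by auto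
      \<comment> \<open>A positive column \<open>j < i\<close> satisfies
        \<open>y i < y j < x j\<close>, so it is counted at level \<open>Suc (y i)\<close>.\<close>
      moreover have "chain \<sigma> True m (upcount X (Suc (y i)))"
        using i(4)
      proof (rule chain_restrict)
        fix j assume "1 \<le> j" "j \<le> i - 1" "\<sigma> j = True"
        then have "1 \<le> j" "j < i" "j \<le> d" "\<sigma> j" using i(1) id by auto
        then show "j \<le> upcount X (Suc (y i))"
          using sgn[of j] dec[of j i] cx[of j "Suc (y i)"] id i(1) by auto
      qed
      ultimately show "\<exists>v\<ge>u. upcount X (Suc v) < upcount Y v \<and> chain \<sigma> True m (upcount X (Suc v))"
        using \<open>u \<le> y i\<close> by (intro exI[of _ "y i"]) auto
    qed
    finally show ?case using 1 by simp
  qed simp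
  then show "alternates True m X Y u \<longleftrightarrow> chain \<sigma> True m (upcount X u)"
    "alternates False m X Y u \<longleftrightarrow> chain \<sigma> False m (upcount Y u)" by blast+
qed

section \<open>Parity blocks\<close>

text \<open>Left ends of the maximal constant runs of \<open>\<sigma>\<close> on
  \<open>{1..d}\<close>. The disjunct \<open>a = 1\<close> shields the definition from the value at
  0.\<close>

definition starts :: "(nat \<Rightarrow> bool) \<Rightarrow> nat \<Rightarrow> nat set" where
  "starts \<sigma> d = {a \<in> {1..d}. a = 1 \<or> \<sigma> (a - 1) \<noteq> \<sigma> a}"

lemma starts_Suc:
  "starts \<sigma> (Suc d) = starts \<sigma> d \<union> (if d = 0 \<or> \<sigma> d \<noteq> \<sigma> (Suc d) then {Suc d} else {})"
  by (auto simp: starts_def le_Suc_eq)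

lemma card_starts_Suc:
  "card (starts \<sigma> (Suc d)) = card (starts \<sigma> d) + of_bool (d = 0 \<or> \<sigma> d \<noteq> \<sigma> (Suc d))"
proof -
  have "Suc d \<notin> starts \<sigma> d" "finite (starts \<sigma> d)" by (auto simp: starts_def)
  then show ?thesis by (simp add: starts_Suc)
qed

text \<open>A longest alternating sequence takes one index from every run, except that the last run
  must be skipped if its sign is not \<open>b\<close>.\<close>

lemma chain_iff_card_starts:
  "chain \<sigma> b m d \<longleftrightarrow> m + of_bool (0 < d \<and> \<sigma> d \<noteq> b) \<le> card (starts \<sigma> d)"
proof (induction d arbitrary: b m)
  case 0
  have "starts \<sigma> 0 = {}" by (auto simp: starts_def)
  then show ?case by (cases m) auto
next
  case (Suc d)
  show ?case
  proof (cases m)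
    case 0
    have "1 \<in> starts \<sigma> (Suc d)" "finite (starts \<sigma> (Suc d))" by (auto simp: starts_def)
    then have "1 \<le> card (starts \<sigma> (Suc d))" by (metis One_nat_def Suc_leI card_gt_0_iff empty_iff)
    with 0 show ?thesis by simp
  next
    case (Suc k)
    \<comment> \<open>Either \<open>Suc d\<close> is the rightmost chosen index or all indices stay
      within \<open>d\<close>.\<close>
    have "chain \<sigma> b m (Suc d) \<longleftrightarrow> (\<sigma> (Suc d) = b \<and> chain \<sigma> (\<not> b) k d) \<or> chain \<sigma> b m d"
    proof -
      have "{1..Suc d} = insert (Suc d) {1..d}" by auto
      then show ?thesis unfolding Suc chain.simps by (simp only: bex_simps) simp
    qed
    also have "\<dots> \<longleftrightarrow> m + of_bool (0 < Suc d \<and> \<sigma> (Suc d) \<noteq> b) \<le> card (starts \<sigma> (Suc d))"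
      unfolding Suc.IH card_starts_Suc using Suc by (cases "d = 0") (auto simp: starts_def)
    finally show ?thesis .
  qed
qed

text \<open>Extend to the right as long as the sign persists. A larger run would have to go beyond
  \<open>b\<close>, against the choice of \<open>b\<close>, or contain \<open>a - 1\<close>, whose
  sign differs.\<close>

lemma block_of_start:
  assumes "a \<in> starts (pos_col xs) (diag xs)"
  obtains b where "a \<le> b" "b \<le> diag xs" "{a..b} \<in> parity_blocks xs"
proof -
  let ?R = "\<lambda>b. a \<le> b \<and> b \<le> diag xs \<and> (\<forall>i\<in>{a..b}. pos_col xs i = pos_col xs a)"
  define b where "b = Greatest ?R"
  have Ra: "?R a" using assms by (auto simp: starts_def)
  then have Rb: "?R b" unfolding b_def by (rule GreatestI_nat[of ?R _ "diag xs"]) simp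
  have bmax: "c \<le> b" if "?R c" for c
    unfolding b_def using that by (rule Greatest_le_nat[of ?R _ "diag xs"]) simp
  have a: "1 \<le> a" "a = 1 \<or> pos_col xs (a - 1) \<noteq> pos_col xs a" using assms by (auto simp: starts_def)
  have run: "same_sign_run xs {a..b}"
    unfolding same_sign_run_def using Rb a(1) by blast
  have "\<not> same_sign_run xs B'" if sub: "{a..b} \<subset> B'" for B'
  proof
    assume "same_sign_run xs B'"
    then obtain a' b' where B': "1 \<le> a'" "b' \<le> diag xs" "B' = {a'..b'}"
      and sg: "\<And>i j. i \<in> B' \<Longrightarrow> j \<in> B' \<Longrightarrow> pos_col xs i = pos_col xs j"
      unfolding same_sign_run_def by blast
    have ab: "a' \<le> a" "b \<le> b'" using sub B' Rb by auto
    have "a \<in> B'" and "{a..b'} \<subseteq> B'" using B' ab Rb by auto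
    then have "\<forall>i\<in>{a..b'}. pos_col xs i = pos_col xs a" using sg by blast
    moreover have "a \<le> b'" using ab Rb by linarith
    ultimately have "?R b'" using B'(2) by blast
    then have "b' = b" using bmax[of b'] ab(2) by (metis le_antisym)
    with sub B' ab have "a' < a" by (auto simp: order.strict_iff_order)
    then have "a - 1 \<in> B'" "a \<in> B'" "a \<noteq> 1" using B' ab Rb by auto
    with sg[of "a - 1" a] a(2) show False by simp
  qed
  with run have "{a..b} \<in> parity_blocks xs" by (simp add: parity_blocks_def)
  with Rb that show thesis by blast
qed

text \<open>If the left end were not a start, the column before it could be added to the
  block.\<close>

lemma parity_block_start:
  assumes "B \<in> parity_blocks xs"
  obtains a b where "a \<in> starts (pos_col xs) (diag xs)" "a \<le> b" "b \<le> diag xs" "B = {a..b}"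
proof -
  have run: "same_sign_run xs B" and mx: "\<And>B'. B \<subset> B' \<Longrightarrow> \<not> same_sign_run xs B'"
    using assms by (simp_all add: parity_blocks_def)
  have sg: "\<And>i j. i \<in> B \<Longrightarrow> j \<in> B \<Longrightarrow> pos_col xs i = pos_col xs j"
    using run unfolding same_sign_run_def by blast
  obtain a b where B: "1 \<le> a" "a \<le> b" "b \<le> diag xs" "B = {a..b}"
    using run unfolding same_sign_run_def by blast
  have "a \<in> starts (pos_col xs) (diag xs)"
  proof (rule ccontr)
    assume "\<not> ?thesis"
    then have a: "2 \<le> a" "pos_col xs (a - 1) = pos_col xs a" using B by (auto simp: starts_def)
    have eq: "{a - 1..b} = insert (a - 1) B" using B a by auto
    have const: "pos_col xs i = pos_col xs a" if "i \<in> {a - 1..b}" for i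
      using that a(2) sg[of i a] B unfolding eq by auto
    have "1 \<le> a - 1" "a - 1 \<le> b" using a(1) B by auto
    moreover have "\<forall>i\<in>{a - 1..b}. \<forall>j\<in>{a - 1..b}. pos_col xs i = pos_col xs j"
      using const by metis
    ultimately have "same_sign_run xs {a - 1..b}"
      unfolding same_sign_run_def using B(3) by blast
    moreover have "B \<subset> {a - 1..b}" using B a by auto
    ultimately show False using mx by blast
  qed
  with B that show thesis by blast
qed

lemma parity_blocks_Min_inj:
  assumes "{a..b} \<in> parity_blocks xs" "{a..c} \<in> parity_blocks xs"
  shows "{a..b} = {a..c}"
proof -
  have "{a..b} \<subseteq> {a..c} \<or> {a..c} \<subseteq> {a..b}" by auto
  with assms show ?thesis unfolding parity_blocks_def by blast
qed

text \<open>Blocks with a common left end are nested, hence equal by maximality; so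
  \<open>Min\<close> is a bijection onto the starts.\<close>

lemma card_parity_blocks: "card (parity_blocks xs) = card (starts (pos_col xs) (diag xs))"
proof (rule bij_betw_same_card)
  show "bij_betw Min (parity_blocks xs) (starts (pos_col xs) (diag xs))"
  proof (rule bij_betwI')
    have Min: "Min {a..b} = a" if "a \<le> b" for a b :: nat
      using that by (intro Min_eqI) auto
    show "(Min B = Min B') = (B = B')" if "B \<in> parity_blocks xs" "B' \<in> parity_blocks xs" for B B'
      using that by (metis parity_block_start parity_blocks_Min_inj Min)
    show "Min B \<in> starts (pos_col xs) (diag xs)" if "B \<in> parity_blocks xs" for B
      using that by (metis parity_block_start Min)
    show "\<exists>B\<in>parity_blocks xs. a = Min B" if "a \<in> starts (pos_col xs) (diag xs)" for a
      using that by (metis block_of_start Min)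
  qed
qed

lemma last_block:
  assumes "1 \<le> diag xs"
  shows "positive_block xs (last_block xs) \<longleftrightarrow> pos_col xs (diag xs)"
    and "negative_block xs (last_block xs) \<longleftrightarrow> \<not> pos_col xs (diag xs)"
proof -
  let ?d = "diag xs" and ?S = "starts (pos_col xs) (diag xs)"
  have "finite ?S" "1 \<in> ?S" using assms by (auto simp: starts_def)
  then have MS: "Max ?S \<in> ?S" "\<And>a. a \<in> ?S \<Longrightarrow> a \<le> Max ?S" by (blast intro: Max_in Max_ge)+
  obtain b where b: "Max ?S \<le> b" "b \<le> ?d" "{Max ?S..b} \<in> parity_blocks xs"
    using block_of_start[OF MS(1)] .
  \<comment> \<open>If the block ended earlier, the next column would be a later start or would have
    the same sign and extend the block.\<close>
  have "b = ?d"
  proof (rule ccontr)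
    assume "b \<noteq> ?d"
    then have bd: "Suc b \<le> ?d" using b by simp
    then have "Suc b \<notin> ?S" using MS(2) b by fastforce
    then have same: "pos_col xs (Suc b) = pos_col xs b" using bd b by (auto simp: starts_def)
    have sg: "pos_col xs i = pos_col xs b" if "i \<in> {Max ?S..b}" for i
    proof -
      have "same_sign_run xs {Max ?S..b}" using b(3) by (simp add: parity_blocks_def)
      then show ?thesis using that b(1) unfolding same_sign_run_def
        by (meson atLeastAtMost_iff order_refl)
    qed
    have "same_sign_run xs {Max ?S..Suc b}"
      unfolding same_sign_run_def
    proof (intro conjI exI)
      show "1 \<le> Max ?S" using MS by (auto simp: starts_def)
      show "\<forall>i\<in>{Max ?S..Suc b}. \<forall>j\<in>{Max ?S..Suc b}. pos_col xs i = pos_col xs j"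
        using sg same by (auto simp: le_Suc_eq)
    qed (use b bd in auto)
    moreover have "{Max ?S..b} \<subset> {Max ?S..Suc b}" using b by auto
    ultimately show False using b(3) unfolding parity_blocks_def by blast
  qed
  with b have ex: "{Max ?S..?d} \<in> parity_blocks xs" "?d \<in> {Max ?S..?d}" by auto
  \<comment> \<open>Two blocks with the same right end are nested, so maximality makes them
    equal.\<close>
  have uniq: "B = {Max ?S..?d}" if B: "B \<in> parity_blocks xs" "?d \<in> B" for B
  proof -
    obtain a c where "c \<le> ?d" "B = {a..c}" using parity_block_start[OF B(1)] by metis
    with B have "B = {a..?d}" by auto
    then have "B \<subseteq> {Max ?S..?d} \<or> {Max ?S..?d} \<subseteq> B" by auto
    with B ex show ?thesis unfolding parity_blocks_def by blast
  qed
  have "last_block xs = {Max ?S..?d}"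
    unfolding last_block_def using ex uniq by (intro the_equality) blast+
  then have lb: "last_block xs \<in> parity_blocks xs" "?d \<in> last_block xs" using ex by simp_all
  have "pos_col xs i = pos_col xs ?d" if "i \<in> last_block xs" for i
    using lb that unfolding parity_blocks_def same_sign_run_def by blast
  with lb(2) show "positive_block xs (last_block xs) \<longleftrightarrow> pos_col xs (diag xs)"
    "negative_block xs (last_block xs) \<longleftrightarrow> \<not> pos_col xs (diag xs)"
    unfolding positive_block_def negative_block_def by blast+
qed

section \<open>Counting partitions\<close>

definition chain_ends :: "nat \<Rightarrow> bool \<Rightarrow> nat \<Rightarrow> nat list set" where
  "chain_ends n b m = {xs \<in> partitions_of n. chain (pos_col xs) b m (diag xs)}"

text \<open>At level 0 every arm and leg is counted, so both counts equal
  \<open>diag xs\<close>.\<close>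

lemma chain_iff_alternates:
  assumes "part_list xs"
  shows "chain (pos_col xs) b m (diag xs) \<longleftrightarrow> alternates b m (arms xs) (legs xs) 0"
proof -
  have *: "pos_col xs i \<longleftrightarrow> leg xs i < arm xs i" if "1 \<le> i" "i \<le> diag xs" for i
    using frob_arm_leg[OF assms, of i] that by (auto simp: pos_col_def)
  have "upcount (arms xs) 0 = diag xs" "upcount (legs xs) 0 = diag xs"
    using card_arms_legs[OF assms] by (simp_all add: upcount_def)
  then show ?thesis
    using alternates_iff_chain[of "diag xs" "arm xs" "leg xs" "pos_col xs", folded arms_def legs_def]
      arm_leg_less[OF assms] * by (cases b) simp_all
qed

lemma finite_partitions_of: "finite (partitions_of n)"
proof (rule finite_subset)
  have "length xs \<le> sum_list xs" if "\<forall>x\<in>set xs. 0 < x" for xs :: "nat list"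
    using that by (induction xs) auto
  then show "partitions_of n \<subseteq> {xs. set xs \<subseteq> {..n} \<and> length xs \<le> n}"
    using member_le_sum_list by (fastforce simp: partitions_of_def is_partition_def)
qed (rule finite_lists_length_le, simp)

lemma card_chain_ends_True:
  "int (card (chain_ends n True m)) = pcount (int n - (3 * int m ^ 2 + int m) div 2)"
proof -
  let ?f = "\<lambda>xs. (arms xs, legs xs)"
  have bij: "bij_betw ?f (partitions_of n) (pairs 0 0 (int n))" by (rule bij_betw_arms_legs)
  have "?f ` chain_ends n True m = alt_pairs m 0 0 (int n)"
  proof -
    have "xs \<in> chain_ends n True m \<longleftrightarrow>
        xs \<in> partitions_of n \<and> (case ?f xs of (X, Y) \<Rightarrow> alternates True m X Y 0)" for xs
      using chain_iff_alternates by (auto simp: chain_ends_def partitions_of_iff)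
    then have "?f ` chain_ends n True m =
        {p \<in> ?f ` partitions_of n. case p of (X, Y) \<Rightarrow> alternates True m X Y 0}"
      by blast
    then show ?thesis using bij by (auto simp: bij_betw_def alt_pairs_def)
  qed
  moreover have "chain_ends n True m \<subseteq> partitions_of n" by (auto simp: chain_ends_def)
  then have "inj_on ?f (chain_ends n True m)"
    using bij inj_on_subset by (auto simp only: bij_betw_def)
  ultimately have "card (chain_ends n True m) = card (alt_pairs m 0 0 (int n))"
    by (metis card_image)
  then show ?thesis using card_alt_pairs_eq_pcount[of 0 m n] by simp
qed

text \<open>Raising the legs by one turns the weak inequality of negative columns into a strict one.\<close>

lemma pairs_Suc_swap: "(Suc ` Y, X) \<in> pairs 0 (Suc 0) N \<longleftrightarrow> (X, Y) \<in> pairs 0 0 N"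
proof -
  have "finite Y \<Longrightarrow> \<Sum>(Suc ` Y) = \<Sum>Y + card Y" by (rule sum_Suc_image)
  then show ?thesis
    by (auto simp: pairs_def card_image finite_image_iff simp del: of_nat_sum)
qed

lemma card_chain_ends_False:
  "int (card (chain_ends n False m)) = pcount (int n - (3 * int m ^ 2 - int m) div 2)"
proof -
  let ?f = "\<lambda>xs. (Suc ` legs xs, arms xs)"
  have alt: "alternates False m X Y 0 \<longleftrightarrow> alternates True m (Suc ` Y) X (Suc 0)" for X Y
    using alternates_transfer(2)[of 0 "Suc ` Y" Y X X 0 m] by (simp add: upcount_Suc_image)
  have inj: "inj_on ?f (partitions_of n)"
    using bij_betw_arms_legs[of n] by (auto simp: bij_betw_def inj_on_def inj_image_eq_iff)
  have "?f ` chain_ends n False m = alt_pairs m 0 1 (int n)"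
  proof (intro set_eqI iffI)
    fix p assume "p \<in> ?f ` chain_ends n False m"
    then obtain xs where xs: "p = ?f xs" "xs \<in> chain_ends n False m" by blast
    then have "(arms xs, legs xs) \<in> pairs 0 0 (int n)"
      using bij_betw_arms_legs[of n] by (auto simp: bij_betw_def chain_ends_def)
    then show "p \<in> alt_pairs m 0 1 (int n)"
      using xs alt chain_iff_alternates
      by (auto simp: alt_pairs_def pairs_Suc_swap chain_ends_def partitions_of_iff)
  next
    fix p assume p: "p \<in> alt_pairs m 0 1 (int n)"
    obtain X' X where q: "p = (X', X)" by force
    define Y where "Y = pred_set X'"
    have X': "X' = Suc ` Y"
      using p Suc_pred_set[of X' 0] by (simp add: q Y_def alt_pairs_def pairs_def)
    then have "(X, Y) \<in> pairs 0 0 (int n)" "alternates False m X Y 0"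
      using p alt by (simp_all add: q alt_pairs_def pairs_Suc_swap)
    moreover from this(1) have "(X, Y) \<in> (\<lambda>xs. (arms xs, legs xs)) ` partitions_of n"
      using bij_betw_arms_legs[of n] by (simp add: bij_betw_def)
    then obtain xs where "xs \<in> partitions_of n" "arms xs = X" "legs xs = Y" by blast
    ultimately show "p \<in> ?f ` chain_ends n False m"
      using q X' chain_iff_alternates
      by (auto simp: chain_ends_def partitions_of_iff intro!: image_eqI[of _ _ xs])
  qed
  moreover have "chain_ends n False m \<subseteq> partitions_of n" by (auto simp: chain_ends_def)
  then have "inj_on ?f (chain_ends n False m)" by (rule inj_on_subset[OF inj])
  ultimately have "card (chain_ends n False m) = card (alt_pairs m 0 1 (int n))"
    by (metis card_image)
  \<comment> \<open>With \<open>a = 1\<close> the additional \<open>int (a * m)\<close> passes from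
    one family of pentagonal numbers to the other.\<close>
  moreover have "(3 * int m ^ 2 + int m) div 2 = (3 * int m ^ 2 - int m) div 2 + int m" by linarith
  ultimately show ?thesis using card_alt_pairs_eq_pcount[of 1 m n] by (simp add: algebra_simps)
qed

text \<open>The sign of the last column stands in for that of the last block; they agree once there
  is a column.\<close>

definition block_count :: "nat \<Rightarrow> bool \<Rightarrow> nat \<Rightarrow> nat" where
  "block_count n b m = card {xs \<in> partitions_of n. card (parity_blocks xs) = m \<and>
     (pos_col xs (diag xs) \<longleftrightarrow> b)}"

lemma diag_pos:
  assumes "xs \<in> partitions_of n" "1 \<le> n"
  shows "1 \<le> diag xs"
proof -
  have "part_list xs" "xs \<noteq> []" using assms by (auto simp: partitions_of_iff)
  then show ?thesis by (cases rule: part_list_cases) (auto simp: diag_add_hook)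
qed

text \<open>Let a partition have \<open>c\<close> blocks. If its last sign is \<open>b\<close>, the
  two chain conditions read \<open>m \<le> c\<close> and \<open>m + 2 \<le> c\<close>, leaving
  \<open>c = m\<close> and \<open>c = m + 1\<close>. Otherwise both read
  \<open>m + 1 \<le> c\<close> and cancel.\<close>

lemma block_count_Suc:
  assumes "1 \<le> n"
  shows "int (block_count n b m) + int (block_count n b (Suc m)) =
    int (card (chain_ends n b m)) - int (card (chain_ends n (\<not> b) (Suc m)))"
proof -
  let ?B = "\<lambda>m. {xs \<in> partitions_of n. card (parity_blocks xs) = m \<and>
    (pos_col xs (diag xs) \<longleftrightarrow> b)}"
  have mem: "xs \<in> chain_ends n c k \<longleftrightarrow> xs \<in> partitions_of n \<and>
      k + of_bool (pos_col xs (diag xs) \<noteq> c) \<le> card (parity_blocks xs)" for xs c k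
    using diag_pos[of xs n] assms
    by (auto simp: chain_ends_def chain_iff_card_starts card_parity_blocks)
  have fin: "finite (?B k)" "finite (chain_ends n c k)" for k c
    by (rule finite_subset[OF _ finite_partitions_of[of n]]; auto simp: chain_ends_def)+
  have "chain_ends n b m = chain_ends n (\<not> b) (Suc m) \<union> (?B m \<union> ?B (Suc m))"
  proof (intro set_eqI)
    fix xs
    show "xs \<in> chain_ends n b m \<longleftrightarrow> xs \<in> chain_ends n (\<not> b) (Suc m) \<union> (?B m \<union> ?B (Suc m))"
      by (cases "pos_col xs (diag xs) \<longleftrightarrow> b") (auto simp: mem)
  qed
  then have "card (chain_ends n b m) = card (chain_ends n (\<not> b) (Suc m)) + card (?B m \<union> ?B (Suc m))"
    using fin by (simp only:) (rule card_Un_disjoint, auto simp: mem)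
  also have "card (?B m \<union> ?B (Suc m)) = card (?B m) + card (?B (Suc m))"
    using fin by (intro card_Un_disjoint) auto
  finally show ?thesis by (simp add: block_count_def)
qed

lemma block_count_0: "1 \<le> n \<Longrightarrow> block_count n b 0 = 0"
proof -
  assume n: "1 \<le> n"
  have "card (parity_blocks xs) \<noteq> 0" if "xs \<in> partitions_of n" for xs
  proof -
    have "1 \<in> starts (pos_col xs) (diag xs)" "finite (starts (pos_col xs) (diag xs))"
      using diag_pos[OF that n] by (auto simp: starts_def)
    then show ?thesis by (auto simp: card_parity_blocks)
  qed
  then have "{xs \<in> partitions_of n. card (parity_blocks xs) = 0 \<and> (pos_col xs (diag xs) \<longleftrightarrow> b)} = {}"
    by blast
  then show ?thesis by (simp only: block_count_def card.empty)
qed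

text \<open>Solves the recursion \<open>block_count_Suc\<close> from the initial value 0: a
  partition of a positive number has at least one block.\<close>

lemma block_count_sum:
  assumes "1 \<le> n"
  shows "int (block_count n b (Suc m)) = (-1) ^ m * (\<Sum>l\<le>m. (-1) ^ l *
    (int (card (chain_ends n b l)) - int (card (chain_ends n (\<not> b) (Suc l)))))"
proof (induction m)
  case 0
  then show ?case using block_count_Suc[OF assms, of b 0] block_count_0[OF assms] by simp
next
  case (Suc m)
  \<comment> \<open>Here \<open>s\<close> stands for \<open>(-1) ^ m\<close>, \<open>S\<close> for
    the sum so far and \<open>C\<close> for the new difference of chain counts.\<close>
  have step: "C - s * S = (- 1 * s) * (S + (- 1 * s) * C)" if "s * s = 1" for s S C :: int
    using that by algebra
  have "(-1 :: int) ^ m * (-1) ^ m = 1" by (simp flip: power_add)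
  note step[OF this]
  moreover have "int (block_count n b (Suc (Suc m))) =
      int (card (chain_ends n b (Suc m))) - int (card (chain_ends n (\<not> b) (Suc (Suc m)))) -
      (-1) ^ m * (\<Sum>l\<le>m. (-1) ^ l *
        (int (card (chain_ends n b l)) - int (card (chain_ends n (\<not> b) (Suc l)))))"
    using block_count_Suc[OF assms, of b "Suc m"] Suc by simp
  ultimately show ?case by (simp only: sum.atMost_Suc power_Suc)
qed

lemma a_eq_block_count:
  assumes "1 \<le> n"
  shows "a_plus m n = block_count n True m" "a_minus m n = block_count n False m"
proof -
  have "{xs \<in> partitions_of n. card (parity_blocks xs) = m \<and> positive_block xs (last_block xs)} =
      {xs \<in> partitions_of n. card (parity_blocks xs) = m \<and> (pos_col xs (diag xs) \<longleftrightarrow> True)}"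
    "{xs \<in> partitions_of n. card (parity_blocks xs) = m \<and> negative_block xs (last_block xs)} =
      {xs \<in> partitions_of n. card (parity_blocks xs) = m \<and> (pos_col xs (diag xs) \<longleftrightarrow> False)}"
    using last_block diag_pos[OF _ assms] by auto
  then show "a_plus m n = block_count n True m" "a_minus m n = block_count n False m"
    by (simp_all only: a_plus_def a_minus_def block_count_def)
qed

theorem theorem5p2:
  fixes m n :: nat
  assumes "1 \<le> m" and "1 \<le> n"
  shows "int (a_plus m n) = (-1) ^ (m - 1) * (\<Sum>l = 0..<m. (-1) ^ l *
            (pcount (int n - (3 * int l ^ 2 + int l) div 2)
             - pcount (int n - (3 * (int l + 1) ^ 2 - (int l + 1)) div 2))) \<and>
         int (a_minus m n) = (-1) ^ (m - 1) * (\<Sum>l = 0..<m. (-1) ^ l *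
            (pcount (int n - (3 * int l ^ 2 - int l) div 2)
             - pcount (int n - (3 * (int l + 1) ^ 2 + (int l + 1)) div 2)))"
proof -
  obtain k where m: "m = Suc k" using assms(1) by (cases m) auto
  have S: "int (Suc l) = int l + 1" for l by simp
  \<comment> \<open>The \<open>l\<close>-th term pairs chains of length \<open>l\<close> ending in
    the wanted sign with chains of length \<open>l + 1\<close> ending in the other, whence the two
    kinds of pentagonal numbers.\<close>
  show ?thesis
    unfolding a_eq_block_count[OF assms(2)] m block_count_sum[OF assms(2)]
      not_True_eq_False not_False_eq_True card_chain_ends_True card_chain_ends_False S
    by (simp only: diff_Suc_1 atLeast0LessThan lessThan_Suc_atMost)
qed

end
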